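(* For all integers $n,\ell\ge1$, let $p(n,\ell)=\operatorname{lcm}\big\{\ell!/(i_1!\cdots i_n!):(i_1,\dots,i_n)\in\mathbf N^n,\ i_1+\dots+i_n=\ell\big\}$. Then $$p(n,\ell)=\prod_{j=1}^{n-1}\frac{\operatorname{lcm}\big(1,2,3,\dots,\lfloor(\ell+n-1)/j\rfloor\big)}{\ell+j}.$$
   Context: $\lfloor\cdot\rfloor$ denotes the integer part; the empty product (for $n=1$) equals $1$. *)

theory Defs
  imports Complex_Main
begin

text \<open>Weak compositions: the parts may be zero, and a tuple indexed by \<open>{1..n}\<close> is a function that vanishes
  elsewhere.\<close>

definition compositions :: "nat \<Rightarrow> nat \<Rightarrow> (nat \<Rightarrow> nat) set" where
  "compositions n l = {i. (\<forall>k. k \<notin> {1..n} \<longrightarrow> i k = 0) \<and> (\<Sum>k=1..n. i k) = l}"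

definition multinomial :: "nat \<Rightarrow> nat \<Rightarrow> (nat \<Rightarrow> nat) \<Rightarrow> nat" where
  "multinomial n l i = fact l div (\<Prod>k=1..n. fact (i k))"

text \<open>The truncating division above is exact on \<open>compositions n l\<close>.\<close>

lemma prod_fact_dvd_fact_sum:
  fixes n :: nat and i :: "nat \<Rightarrow> nat"
  shows "(\<Prod>k=1..n. fact (i k) :: nat) dvd fact (\<Sum>k=1..n. i k)"
proof (induction n)
  case 0
  show ?case by simp
next
  case (Suc n)
  have "fact (\<Sum>k=1..n. i k) * fact (i (Suc n)) dvd
      (fact ((\<Sum>k=1..n. i k) + i (Suc n)) :: nat)"
    by (rule fact_fact_dvd_fact)
  with Suc.IH show ?case
    by (auto intro: dvd_trans mult_dvd_mono)
qed

lemma of_nat_multinomial: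
  assumes "i \<in> compositions n l"
  shows "real (multinomial n l i) = fact l / (\<Prod>k=1..n. fact (i k))"
  using assms prod_fact_dvd_fact_sum[where i = i and n = n]
  by (auto simp: compositions_def multinomial_def real_of_nat_div)

text \<open>The set below is finite (this matters, as \<^term>\<open>Lcm A = (0 :: nat)\<close> for infinite \<open>A\<close>).\<close>

definition lcm_multinomial :: "nat \<Rightarrow> nat \<Rightarrow> nat" where
  "lcm_multinomial n l = Lcm (multinomial n l ` compositions n l)"

lemma finite_compositions: "finite (compositions n l)"
proof (rule finite_subset)
  show "compositions n l \<subseteq> {i. \<forall>k. (k \<in> {1..n} \<longrightarrow> i k \<in> {..l}) \<and> (k \<notin> {1..n} \<longrightarrow> i k = 0)}"
    using member_le_sum[where A = "{1..n}" and f = "i :: nat \<Rightarrow> nat" for i]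
    by (fastforce simp: compositions_def)
  show "finite {i :: nat \<Rightarrow> nat. \<forall>k. (k \<in> {1..n} \<longrightarrow> i k \<in> {..l}) \<and> (k \<notin> {1..n} \<longrightarrow> i k = 0)}"
    by (rule finite_set_of_finite_funs) auto
qed

end

theory Submission
  imports Defs "HOL-Computational_Algebra.Primes"
begin

text \<open>Put \<open>N = l + n - 1\<close> and clear denominators; both sides are compared one prime \<open>p\<close> at a time. By
  Legendre's formula the valuations become sums over \<open>r \<ge> 1\<close>, the product of the \<open>Lcm {1..N div j}\<close>
  contributing \<open>min (n - 1) (N div p\<^sup>r)\<close>. The claim is then that the minimum over all compositions of
  \<open>\<Sum>\<^sub>r \<Sum>\<^sub>k i\<^sub>k div p\<^sup>r\<close> equals \<open>\<Sum>\<^sub>r max 0 (N div p\<^sup>r - (n - 1))\<close>. The bound holds for each \<open>r\<close>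
  separately, and a single composition attains all of them.\<close>

section \<open>Valuations of factorials and of \<open>Lcm {1..m}\<close>\<close>

text \<open>The exponents of the dividing powers form an initial segment, and
  \<open>r < 2 ^ r\<close> keeps it below \<open>x\<close>. The free cap \<open>L\<close> lets all
  later sums share one index range.\<close>

lemma multiplicity_eq_card_powers:
  fixes p x L :: nat
  assumes "prime p" "0 < x" "x \<le> L"
  shows "multiplicity p x = card {r \<in> {1..L}. p ^ r dvd x}"
proof -
  have "multiplicity p x \<le> L"
  proof -
    have "multiplicity p x < 2 ^ multiplicity p x" by (rule less_exp)
    also have "\<dots> \<le> p ^ multiplicity p x"
      using prime_ge_2_nat[OF \<open>prime p\<close>] by (intro power_mono) auto
    also have "\<dots> \<le> x"
      using \<open>0 < x\<close> by (intro dvd_imp_le multiplicity_dvd)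
    finally show ?thesis using assms by simp
  qed
  moreover have *: "p ^ r dvd x \<longleftrightarrow> r \<le> multiplicity p x" for r
    using assms by (intro power_dvd_iff_le_multiplicity) (auto simp: prime_gt_1_nat)
  ultimately have "{r \<in> {1..L}. p ^ r dvd x} = {1..multiplicity p x}"
    unfolding * by (intro set_eqI) (simp, linarith)
  thus ?thesis by simp
qed

text \<open>Legendre's formula; terms with \<open>p ^ r > n\<close> vanish. From \<open>n\<close> to
  \<open>Suc n\<close>, the quotient by \<open>p ^ r\<close> grows by one exactly when
  \<open>p ^ r\<close> divides \<open>Suc n\<close>.\<close>

lemma legendre_multiplicity_fact:
  fixes p n L :: nat
  assumes "prime p" "n \<le> L"
  shows "multiplicity p (fact n) = (\<Sum>r=1..L. n div p ^ r)"
  using \<open>n \<le> L\<close>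
proof (induction n)
  case 0
  show ?case by simp
next
  case (Suc n)
  have "multiplicity p (fact (Suc n) :: nat) = multiplicity p (Suc n) + multiplicity p (fact n :: nat)"
    unfolding fact_Suc of_nat_id
    using assms by (intro prime_elem_multiplicity_mult_distrib) auto
  also have "multiplicity p (Suc n) = (\<Sum>r=1..L. if p ^ r dvd Suc n then 1 else 0)"
    using multiplicity_eq_card_powers[of p "Suc n" L] Suc.prems assms
    by (simp add: sum.If_cases Int_def)
  also have "\<dots> + multiplicity p (fact n :: nat)
      = (\<Sum>r=1..L. (if p ^ r dvd Suc n then 1 else 0) + n div p ^ r)"
    using Suc by (simp add: sum.distrib)
  also have "\<dots> = (\<Sum>r=1..L. Suc n div p ^ r)"
    by (intro sum.cong) (auto simp: div_Suc dvd_eq_mod_eq_0)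
  finally show ?case .
qed

lemma multiplicity_Lcm_le:
  fixes A :: "nat set"
  assumes "prime p" "finite A" "0 \<notin> A" "\<And>a. a \<in> A \<Longrightarrow> multiplicity p a \<le> m"
  shows "multiplicity p (Lcm A) \<le> m"
  using assms(2-)
proof (induction A rule: finite_induct)
  case empty
  show ?case by simp
next
  case (insert a A)
  have "Lcm A \<noteq> 0" using insert by (simp add: Lcm_0_iff)
  hence "multiplicity p (lcm a (Lcm A)) = max (multiplicity p a) (multiplicity p (Lcm A))"
    using insert \<open>prime p\<close> by (intro multiplicity_lcm) auto
  thus ?case using insert by simp
qed

text \<open>A power \<open>p ^ r \<le> m\<close> is itself one of the numbers in the range, and a
  larger power divides none of them.\<close>

lemma multiplicity_Lcm_atLeastAtMost:
  fixes p m L :: nat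
  assumes "prime p" "m \<le> L"
  shows "multiplicity p (Lcm {1..m}) = card {r \<in> {1..L}. p ^ r \<le> m}"
proof (cases "m = 0")
  case True
  have "p ^ r > 0" for r using \<open>prime p\<close> by (simp add: prime_gt_0_nat)
  with True show ?thesis by simp
next
  case False
  define t where "t = card {r \<in> {1..L}. p ^ r \<le> m}"
  have nz: "Lcm {1..m} \<noteq> 0" by (simp add: Lcm_0_iff)
  show ?thesis
  proof (rule antisym)
    show "multiplicity p (Lcm {1..m}) \<le> card {r \<in> {1..L}. p ^ r \<le> m}"
    proof (rule multiplicity_Lcm_le)
      fix a assume a: "a \<in> {1..m}"
      hence "multiplicity p a = card {r \<in> {1..L}. p ^ r dvd a}"
        using assms by (intro multiplicity_eq_card_powers) auto
      also have "\<dots> \<le> card {r \<in> {1..L}. p ^ r \<le> m}"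
        using a by (intro card_mono) (auto dest!: dvd_imp_le)
      finally show "multiplicity p a \<le> card {r \<in> {1..L}. p ^ r \<le> m}" .
    qed (use assms in auto)
  next
    have "{r \<in> {1..L}. p ^ r \<le> m} \<subseteq> {1..multiplicity p (Lcm {1..m})}"
    proof safe
      fix r assume r: "r \<in> {1..L}" "p ^ r \<le> m"
      have "p ^ r dvd Lcm {1..m}"
        using r \<open>prime p\<close> by (intro dvd_Lcm) (auto simp: Suc_le_eq prime_gt_0_nat)
      hence "r \<le> multiplicity p (Lcm {1..m})"
        using nz \<open>prime p\<close> by (intro multiplicity_geI) (auto simp: prime_gt_1_nat)
      thus "r \<in> {1..multiplicity p (Lcm {1..m})}" using r by auto
    qed
    from card_mono[OF _ this] show "card {r \<in> {1..L}. p ^ r \<le> m} \<le> multiplicity p (Lcm {1..m})"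
      by simp
  qed
qed

text \<open>Double counting of the pairs \<open>(j, r)\<close> with
  \<open>j * p ^ r \<le> N\<close>, first by \<open>j\<close> and then by \<open>r\<close>.\<close>

lemma sum_multiplicity_Lcm:
  fixes p n N L :: nat
  assumes "prime p" "N \<le> L"
  shows "(\<Sum>j=1..n. multiplicity p (Lcm {1..N div j})) = (\<Sum>r=1..L. min n (N div p ^ r))"
proof -
  have q: "p ^ r > 0" for r using \<open>prime p\<close> by (simp add: prime_gt_0_nat)
  have "(\<Sum>j=1..n. multiplicity p (Lcm {1..N div j}))
      = (\<Sum>j=1..n. \<Sum>r=1..L. if p ^ r \<le> N div j then 1 else 0)"
  proof (rule sum.cong)
    fix j assume "j \<in> {1..n}"
    have "N div j \<le> L" using div_le_dividend[of N j] assms by linarith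
    thus "multiplicity p (Lcm {1..N div j}) = (\<Sum>r=1..L. if p ^ r \<le> N div j then 1 else 0)"
      using multiplicity_Lcm_atLeastAtMost[of p "N div j" L] assms by (simp add: sum.If_cases Int_def)
  qed simp
  also have "\<dots> = (\<Sum>r=1..L. \<Sum>j=1..n. if p ^ r \<le> N div j then 1 else 0)"
    by (rule sum.swap)
  also have "\<dots> = (\<Sum>r=1..L. min n (N div p ^ r))"
  proof (rule sum.cong)
    fix r
    have "{1..n} \<inter> {j. p ^ r \<le> N div j} = {1..min n (N div p ^ r)}"
      using q[of r] by (auto simp: less_eq_div_iff_mult_less_eq mult.commute)
    thus "(\<Sum>j=1..n. if p ^ r \<le> N div j then 1 else 0) = min n (N div p ^ r)"
      by (simp add: sum.If_cases)
  qed simp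
  finally show ?thesis .
qed

section \<open>Valuations of multinomial coefficients\<close>

lemma multinomial_mult:
  assumes "i \<in> compositions n l"
  shows "multinomial n l i * (\<Prod>k=1..n. fact (i k)) = fact l"
  using assms prod_fact_dvd_fact_sum[of i n] by (auto simp: compositions_def multinomial_def)

lemma multinomial_pos:
  assumes "i \<in> compositions n l"
  shows "multinomial n l i > 0"
  using multinomial_mult[OF assms] by (metis fact_gt_zero mult_is_0 not_gr_zero)

text \<open>Legendre's formula for each factorial, in additive form to avoid subtraction in
  \<open>nat\<close>: a small sum of quotients means a large valuation.\<close>

lemma multiplicity_multinomial:
  fixes p :: nat
  assumes "prime p" "i \<in> compositions n l" "l \<le> L"
  shows "multiplicity p (multinomial n l i) + (\<Sum>r=1..L. \<Sum>k=1..n. i k div p ^ r)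
    = (\<Sum>r=1..L. l div p ^ r)"
proof -
  have le: "i k \<le> L" if "k \<in> {1..n}" for k
    using that assms(2,3) member_le_sum[of k "{1..n}" i] by (auto simp: compositions_def)
  have "(\<Sum>r=1..L. l div p ^ r) = multiplicity p (fact l)"
    using assms by (simp add: legendre_multiplicity_fact)
  also have "\<dots> = multiplicity p (multinomial n l i * (\<Prod>k=1..n. fact (i k)))"
    by (simp only: multinomial_mult[OF assms(2)])
  also have "\<dots> = multiplicity p (multinomial n l i) + multiplicity p (\<Prod>k=1..n. fact (i k))"
    using multinomial_pos[OF assms(2)] assms(1)
    by (intro prime_elem_multiplicity_mult_distrib) auto
  also have "multiplicity p (\<Prod>k=1..n. fact (i k)) = (\<Sum>k=1..n. multiplicity p (fact (i k)))"
    using assms(1) by (intro prime_elem_multiplicity_prod_distrib) auto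
  also have "\<dots> = (\<Sum>k=1..n. \<Sum>r=1..L. i k div p ^ r)"
    using le assms(1) by (intro sum.cong legendre_multiplicity_fact) auto
  also have "\<dots> = (\<Sum>r=1..L. \<Sum>k=1..n. i k div p ^ r)"
    by (rule sum.swap)
  finally show ?thesis by simp
qed

section \<open>The lower bound for the quotient sums and its sharpness\<close>

lemma div_le_sum_div_add:
  fixes n q :: nat
  assumes "q > 0" "n \<ge> 1"
  shows "((\<Sum>k=1..n. i k) + n - 1) div q \<le> (\<Sum>k=1..n. i k div q) + (n - 1)"
proof -
  \<comment> \<open>Rounding \<open>i k + 1\<close> up to a multiple of \<open>q\<close> brings in
    one unit per part. Dropping a single unit at the end makes the inequality strict, whence
    \<open>n - 1\<close> rather than \<open>n\<close>.\<close>
  have "(\<Sum>k=1..n. i k) + n = (\<Sum>k=1..n. i k + 1)" by (simp add: sum_Suc)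
  also have "\<dots> \<le> (\<Sum>k=1..n. (i k div q + 1) * q)"
  proof (rule sum_mono)
    fix k
    have "i k < (i k div q + 1) * q"
      using \<open>q > 0\<close> by (simp only: div_less_iff_less_mult[symmetric])
    thus "i k + 1 \<le> (i k div q + 1) * q" by simp
  qed
  also have "\<dots> = ((\<Sum>k=1..n. i k div q) + n) * q"
    by (simp only: sum_distrib_right[symmetric] sum.distrib) simp
  finally have "(\<Sum>k=1..n. i k) + n - 1 < ((\<Sum>k=1..n. i k div q) + n) * q"
    using \<open>n \<ge> 1\<close> by linarith
  hence "((\<Sum>k=1..n. i k) + n - 1) div q < (\<Sum>k=1..n. i k div q) + n"
    using \<open>q > 0\<close> by (simp add: div_less_iff_less_mult)
  thus ?thesis using \<open>n \<ge> 1\<close> by linarith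
qed

text \<open>Greedy choice: the last summand takes \<open>min m c\<close>, and what remains fits into
  the others.\<close>

lemma ex_bounded_summands:
  fixes n c m :: nat
  assumes "m \<le> n * c"
  shows "\<exists>a. (\<forall>k. a k \<le> c) \<and> (\<Sum>k=1..n. a k) = m"
  using assms
proof (induction n arbitrary: m)
  case 0
  thus ?case by (intro exI[of _ "\<lambda>_. 0"]) auto
next
  case (Suc n)
  have "m - min m c \<le> n * c" using Suc.prems by auto
  then obtain a where a: "\<forall>k. a k \<le> c" "(\<Sum>k=1..n. a k) = m - min m c"
    using Suc.IH by blast
  show ?case
    by (rule exI[of _ "a(Suc n := min m c)"]) (use a in auto)
qed

text \<open>With \<open>R\<close> maximal such that \<open>n p\<^sup>R \<le> N\<close> for \<open>N = l + n\<close>, all parts but the last get \<open>R\<close> trailing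
  base-\<open>p\<close> digits equal to \<open>p - 1\<close> and at most one further digit; the last part is below \<open>p\<^sup>R\<close>. The
  lower bounds for \<open>\<Sum>k. i\<^sub>k div p\<^sup>r\<close> are then attained for all \<open>r\<close> at once.\<close>

lemma ex_extremal_composition:
  fixes p n l :: nat
  assumes "p \<ge> 2" "n \<ge> 1"
  obtains i where "i \<in> compositions (Suc n) l"
    "\<And>r. (l + n) div p ^ r = (\<Sum>k=1..Suc n. i k div p ^ r) + min n ((l + n) div p ^ r)"
proof -
  define N where "N = l + n"
  \<comment> \<open>Together with the exponent 0, admissible because \<open>n \<le> N\<close>, this
    makes the \<open>GREATEST\<close> below well defined.\<close>
  have bound: "R \<le> N" if "n * p ^ R \<le> N" for R
  proof -
    have "R < 2 ^ R" by (rule less_exp)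
    also have "\<dots> \<le> p ^ R" using assms by (intro power_mono) auto
    also have "\<dots> \<le> n * p ^ R" using assms by simp
    finally show ?thesis using that by simp
  qed
  define R where "R = (GREATEST R. n * p ^ R \<le> N)"
  have R: "n * p ^ R \<le> N"
    unfolding R_def by (rule GreatestI_nat[where k = 0 and b = N]) (use bound in \<open>auto simp: N_def\<close>)
  have R': "N < n * p ^ Suc R"
  proof (rule ccontr)
    assume "\<not> ?thesis"
    hence "Suc R \<le> R"
      unfolding R_def by (intro Greatest_le_nat[where b = N]) (use bound in auto)
    thus False by simp
  qed
  define P where "P = p ^ R"
  have P: "P > 0" using assms by (simp add: P_def)
  \<comment> \<open>The first \<open>n\<close> parts will be \<open>(a k + 1) * P - 1\<close>, with
    leading digit \<open>a k\<close>. The factors \<open>a k + 1\<close> must add up to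
    \<open>N div P\<close>, so the digits add up to \<open>m\<close>.\<close>
  define m where "m = N div P - n"
  have nN: "n \<le> N div P" using R P by (simp add: less_eq_div_iff_mult_less_eq P_def)
  have "N div P < n * p" using R' P by (simp add: div_less_iff_less_mult P_def mult_ac)
  hence "m \<le> n * (p - 1)" by (simp add: m_def diff_mult_distrib2)
  then obtain a where a: "\<And>k. a k \<le> p - 1" "(\<Sum>k=1..n. a k) = m"
    using ex_bounded_summands by blast
  define i where "i = (\<lambda>k. if k \<in> {1..n} then (a k + 1) * P - 1 else if k = Suc n then N mod P else 0)"
  have suma: "(\<Sum>k=1..n. a k + 1) = N div P"
    using a nN by (simp add: sum_Suc m_def)
  have sum_i: "(\<Sum>k=1..n. f ((a k + 1) * P - 1)) + f (N mod P) = (\<Sum>k=1..Suc n. f (i k))" for f :: "nat \<Rightarrow> nat"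
    by (simp add: i_def)
  have key: "(\<Sum>k=1..Suc n. i k div p ^ r) + n = N div p ^ r" if "r \<le> R" for r
  proof -
    define Q where "Q = p ^ (R - r)"
    have PQ: "P = Q * p ^ r" using that by (simp add: P_def Q_def flip: power_add)
    have q: "p ^ r > 0" "Q > 0" using assms by (auto simp: Q_def)
    \<comment> \<open>As \<open>p ^ r\<close> divides \<open>P\<close>, each of these parts is one
      less than a positive multiple of \<open>p ^ r\<close>, so no smaller quotient is lost to
      rounding in the sum.\<close>
    have d: "((a k + 1) * P - 1) div p ^ r + 1 = (a k + 1) * Q" for k
    proof -
      obtain s where s: "(a k + 1) * Q = Suc s"
        using q by (metis Suc_eq_plus1 not0_implies_Suc mult_is_0 nat.distinct(1) not_gr_zero)
      have "(a k + 1) * P = Suc s * p ^ r"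
        by (simp only: PQ s mult.assoc[symmetric])
      hence e: "(a k + 1) * P = p ^ r + p ^ r * s"
        by (simp only: mult_Suc mult.commute[of s])
      have "((a k + 1) * P - 1) div p ^ r = s"
        by (intro div_nat_eqI; unfold e mult_Suc_right; use q in linarith)
      thus ?thesis unfolding s by simp
    qed
    have "(\<Sum>k=1..n. ((a k + 1) * P - 1) div p ^ r) + n = (\<Sum>k=1..n. ((a k + 1) * P - 1) div p ^ r + 1)"
      by (simp only: sum.distrib) simp
    also have "\<dots> = (N div P) * Q"
      unfolding d suma[symmetric] by (simp only: sum_distrib_right)
    finally have "(\<Sum>k=1..Suc n. i k div p ^ r) + n = (N div P) * Q + (N mod P) div p ^ r"
      using sum_i[of "\<lambda>x. x div p ^ r"] by linarith
    also have "\<dots> = ((N div P) * Q * p ^ r + N mod P) div p ^ r"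
      using q by simp
    also have "(N div P) * Q * p ^ r + N mod P = N"
      using div_mult_mod_eq[of N P] by (simp add: PQ mult.assoc)
    finally show ?thesis .
  qed
  show thesis
  proof
    \<comment> \<open>At \<open>r = 0\<close> the divisor is 1, so \<open>key\<close> says that the
      parts plus \<open>n\<close> give \<open>N\<close>.\<close>
    have "(\<Sum>k=1..Suc n. i k) = l"
      using key[of 0] by (simp add: N_def)
    moreover have "i k = 0" if "k \<notin> {1..Suc n}" for k
      using that by (auto simp: i_def)
    ultimately show "i \<in> compositions (Suc n) l"
      by (simp add: compositions_def)
    fix r
    show "(l + n) div p ^ r = (\<Sum>k=1..Suc n. i k div p ^ r) + min n ((l + n) div p ^ r)"
    proof (cases "r \<le> R")
      case True
      thus ?thesis using key[OF True] by (simp add: N_def)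
    next
      case False
      \<comment> \<open>Beyond \<open>R\<close> all parts are below \<open>p ^ r\<close>, so their
        quotients vanish; maximality of \<open>R\<close> makes the minimum equal to
        \<open>N div p ^ r\<close>.\<close>
      hence pr: "p * P \<le> p ^ r"
        using assms power_increasing[of "Suc R" r p] by (simp add: P_def)
      have "i k < p ^ r" for k
      proof -
        have "(a k + 1) * P \<le> p * P" using a(1)[of k] assms by (intro mult_right_mono) auto
        moreover have "N mod P < p * P"
          using P assms less_le_trans[OF mod_less_divisor[OF P]] by simp
        ultimately show ?thesis using pr P assms(1) by (auto simp: i_def)
      qed
      hence "(\<Sum>k=1..Suc n. i k div p ^ r) = 0" by simp
      moreover have "N div p ^ r \<le> n"
      proof -
        have "N < n * p ^ Suc R" by (rule R')
        also have "\<dots> \<le> n * p ^ r" using pr by (simp add: P_def)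
        finally show ?thesis using pr P assms
          by (intro less_imp_le) (simp add: div_less_iff_less_mult)
      qed
      ultimately show ?thesis by (simp add: N_def)
    qed
  qed
qed

section \<open>Comparison of both sides prime by prime\<close>

lemma multiplicity_lcm_multinomial:
  fixes p n l L :: nat
  assumes "prime p" "l + n \<le> L" "n \<ge> 1"
  shows "multiplicity p (lcm_multinomial (Suc n) l) + (\<Sum>r=1..L. (l + n) div p ^ r)
    = (\<Sum>r=1..L. l div p ^ r) + (\<Sum>r=1..L. min n ((l + n) div p ^ r))"
proof -
  let ?A = "multinomial (Suc n) l ` compositions (Suc n) l"
  have fin: "finite ?A" by (intro finite_imageI finite_compositions)
  have nz: "0 \<notin> ?A" using multinomial_pos by fastforce
  have lnz: "Lcm ?A \<noteq> 0" using fin nz by (simp add: Lcm_0_iff)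
  have p: "p \<ge> 2" "\<And>r. p ^ r > 0" using assms(1) by (auto simp: prime_ge_2_nat prime_gt_0_nat)
  have le: "multiplicity p (multinomial (Suc n) l i) + (\<Sum>r=1..L. (l + n) div p ^ r)
      \<le> (\<Sum>r=1..L. l div p ^ r) + (\<Sum>r=1..L. min n ((l + n) div p ^ r))"
    if i: "i \<in> compositions (Suc n) l" for i
  proof -
    \<comment> \<open>If the minimum is the quotient itself, this is trivial; otherwise it is the
      bound for \<open>Suc n\<close> parts.\<close>
    have "(l + n) div p ^ r \<le> (\<Sum>k=1..Suc n. i k div p ^ r) + min n ((l + n) div p ^ r)" for r
      using div_le_sum_div_add[of "p ^ r" "Suc n" i] i p by (auto simp: compositions_def min_def)
    hence "(\<Sum>r=1..L. (l + n) div p ^ r)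
        \<le> (\<Sum>r=1..L. (\<Sum>k=1..Suc n. i k div p ^ r) + min n ((l + n) div p ^ r))"
      by (intro sum_mono)
    thus ?thesis
      using multiplicity_multinomial[of p i "Suc n" l L, OF assms(1) i] assms(2) unfolding sum.distrib by linarith
  qed
  obtain i where i: "i \<in> compositions (Suc n) l"
    "\<And>r. (l + n) div p ^ r = (\<Sum>k=1..Suc n. i k div p ^ r) + min n ((l + n) div p ^ r)"
    using ex_extremal_composition[of p n l] p assms by blast
  have "(\<Sum>r=1..L. (l + n) div p ^ r)
        = (\<Sum>r=1..L. (\<Sum>k=1..Suc n. i k div p ^ r) + min n ((l + n) div p ^ r))"
    by (intro sum.cong i(2)) simp
  hence eq: "multiplicity p (multinomial (Suc n) l i) + (\<Sum>r=1..L. (l + n) div p ^ r)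
      = (\<Sum>r=1..L. l div p ^ r) + (\<Sum>r=1..L. min n ((l + n) div p ^ r))"
    using multiplicity_multinomial[of p i "Suc n" l L, OF assms(1) i(1)] assms(2) unfolding sum.distrib by linarith
  \<comment> \<open>The lcm has the largest valuation among the coefficients, which \<open>i\<close>
    attains. That \<open>i\<close> depends on \<open>p\<close> does no harm, since each prime is
    treated on its own.\<close>
  have "multiplicity p (Lcm ?A) = multiplicity p (multinomial (Suc n) l i)"
  proof (rule antisym)
    show "multiplicity p (Lcm ?A) \<le> multiplicity p (multinomial (Suc n) l i)"
    proof (rule multiplicity_Lcm_le[OF assms(1) fin nz])
      fix b assume "b \<in> ?A"
      thus "multiplicity p b \<le> multiplicity p (multinomial (Suc n) l i)"
        using le eq by fastforce
    qed
    show "multiplicity p (multinomial (Suc n) l i) \<le> multiplicity p (Lcm ?A)"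
      using lnz i(1) by (intro dvd_imp_multiplicity_le dvd_Lcm) auto
  qed
  thus ?thesis using eq by (simp add: lcm_multinomial_def)
qed

lemma lcm_multinomial_mult_fact:
  "lcm_multinomial (Suc n) l * fact (l + n) = fact l * (\<Prod>j=1..n. Lcm {1..(l + n) div j})"
\<comment> \<open>A single part is handled directly: for \<open>n = 0\<close> no maximal
  \<open>R\<close> with \<open>n * p ^ R \<le> N\<close> exists.\<close>
proof (cases "n = 0")
  case True
  have "multinomial (Suc 0) l i = 1" if "i \<in> compositions (Suc 0) l" for i
    using multinomial_mult[OF that] that by (auto simp: compositions_def)
  moreover have "(\<lambda>k. if k = 1 then l else 0) \<in> compositions (Suc 0) l"
    by (auto simp: compositions_def)
  ultimately have "multinomial (Suc 0) l ` compositions (Suc 0) l = {1}" by auto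
  thus ?thesis using True by (simp add: lcm_multinomial_def)
next
  case False
  have nz1: "lcm_multinomial (Suc n) l \<noteq> 0"
    using multinomial_pos[of _ "Suc n" l] finite_compositions[of "Suc n" l]
    unfolding lcm_multinomial_def by (subst Lcm_0_iff) fastforce+
  have nz2: "Lcm {1..(l + n) div j} \<noteq> 0" for j by (simp add: Lcm_0_iff)
  have pos: "Lcm {1..(l + n) div j} > 0" for j using nz2 by blast
  show ?thesis
  proof (rule multiplicity_eq_nat)
    fix p :: nat assume p: "prime p"
    let ?L = "l + n"
    have "multiplicity p (lcm_multinomial (Suc n) l * fact (l + n))
        = multiplicity p (lcm_multinomial (Suc n) l) + multiplicity p (fact (l + n))"
      using nz1 p by (intro prime_elem_multiplicity_mult_distrib) auto
    also have "\<dots> = multiplicity p (fact l) + (\<Sum>r=1..?L. min n ((l + n) div p ^ r))"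
      using multiplicity_lcm_multinomial[of p l n ?L] p False
      by (simp add: legendre_multiplicity_fact[where L = ?L])
    also have "(\<Sum>r=1..?L. min n ((l + n) div p ^ r)) = (\<Sum>j=1..n. multiplicity p (Lcm {1..(l + n) div j}))"
      using p by (intro sum_multiplicity_Lcm[symmetric]) auto
    also have "\<dots> = multiplicity p (\<Prod>j=1..n. Lcm {1..(l + n) div j})"
      using p nz2 by (intro prime_elem_multiplicity_prod_distrib[symmetric]) auto
    also have "multiplicity p (fact l) + \<dots> = multiplicity p (fact l * (\<Prod>j=1..n. Lcm {1..(l + n) div j}))"
      using p nz2 by (intro prime_elem_multiplicity_mult_distrib[symmetric]) auto
    finally show "multiplicity p (lcm_multinomial (Suc n) l * fact (l + n))
        = multiplicity p (fact l * (\<Prod>j=1..n. Lcm {1..(l + n) div j}))" .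
  qed (use nz1 pos in \<open>auto simp del: One_nat_def\<close>)
qed

lemma fact_mult_prod_add: "fact l * (\<Prod>j=1..n. l + j) = (fact (l + n) :: nat)"
  by (induction n) (auto simp: algebra_simps)

theorem theorem8p1:
  fixes n l :: nat
  assumes "n \<ge> 1" and "l \<ge> 1"
  shows "real (lcm_multinomial n l) =
    (\<Prod>j=1..n-1. real (Lcm {1..nat \<lfloor>real (l + n - 1) / real j\<rfloor>}) / real (l + j))"
proof -
  obtain m where n: "n = Suc m" using assms(1) by (cases n) auto
  \<comment> \<open>The factor \<open>fact l\<close> completes the denominators to a factorial and
    is cancelled afterwards.\<close>
  have "fact l * (lcm_multinomial n l * (\<Prod>j=1..m. l + j)) = lcm_multinomial n l * fact (l + m)"
    by (simp only: fact_mult_prod_add[symmetric] mult_ac)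
  also have "\<dots> = fact l * (\<Prod>j=1..m. Lcm {1..(l + m) div j})"
    unfolding n by (rule lcm_multinomial_mult_fact)
  finally have "lcm_multinomial n l * (\<Prod>j=1..m. l + j) = (\<Prod>j=1..m. Lcm {1..(l + m) div j})"
    by simp
  hence "real (lcm_multinomial n l) * (\<Prod>j=1..m. real (l + j)) = (\<Prod>j=1..m. real (Lcm {1..(l + m) div j}))"
    by (metis of_nat_mult of_nat_prod)
  moreover have "(\<Prod>j=1..m. real (l + j)) \<noteq> 0" using assms(2) by simp
  ultimately have "real (lcm_multinomial n l) = (\<Prod>j=1..m. real (Lcm {1..(l + m) div j}) / real (l + j))"
    by (simp add: prod_dividef eq_divide_eq)
  thus ?thesis by (simp only: n floor_divide_of_nat_eq nat_int add_Suc_right diff_Suc_1)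
qed

end
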